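(* Let $\mathcal{A}$ be a nonempty compact $\mathcal{H}$-set of positive $N\times M$ matrices and let $\mathcal{B}$ be a nonempty compact $\mathcal{H}$-set of positive $M\times N$ matrices. Then $$\mu(\mathcal{A},\mathcal{B})=\eta(\mathcal{A},\mathcal{B})=\hat{\mu}(\mathcal{A},\mathcal{B})=\hat{\eta}(\mathcal{A},\mathcal{B})=\check{\mu}(\mathcal{A},\mathcal{B})=\check{\eta}(\mathcal{A},\mathcal{B}).$$
   Context: A vector or matrix is positive if all its entries are strictly positive. For vectors $x,y$, $x\geqslant y$ means that each coordinate of $x$ is not less than the corresponding coordinate of $y$ (and $x\leqslant y$ means $y\geqslant x$). A set $\mathcal{A}$ of positive real $N\times M$ matrices is called an $\mathcal{H}$-set (hourglass set) if for each pair $(\tilde{A},u)$, where $\tilde{A}\in\mathcal{A}$ and $u\in\mathbb{R}^M$ is a positive vector, both of the following hold: (1) either $Au\geqslant\tilde{A}u$ for all $A\in\mathcal{A}$, or there exists $\bar{A}\in\mathcal{A}$ such that $\bar{A}u\leqslant\tilde{A}u$ and $\bar{A}u\neq\tilde{A}u$; (2) either $Au\leqslant\tilde{A}u$ for all $A\in\mathcal{A}$, or there exists $\bar{A}\in\mathcal{A}$ such that $\bar{A}u\geqslant\tilde{A}u$ and $\bar{A}u\neq\tilde{A}u$. Let $\rho(\cdot)$ denote the spectral radius of a square matrix and $\|\cdot\|$ a norm on the real $N\times N$ matrices. For $n\ge1$, with all $A_i$ ranging over $\mathcal{A}$ and all $B_i$ over $\mathcal{B}$ ($i=1,\ldots,n$),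 set $$\mu_n(\mathcal{A},\mathcal{B})=\max_{A_i}\min_{B_i}\|A_nB_n\cdots A_1B_1\|,\qquad \eta_n(\mathcal{A},\mathcal{B})=\min_{B_i}\max_{A_i}\|A_nB_n\cdots A_1B_1\|,$$ $$\bar{\mu}_n(\mathcal{A},\mathcal{B})=\max_{A_i}\min_{B_i}\rho(A_nB_n\cdots A_1B_1),\qquad \bar{\eta}_n(\mathcal{A},\mathcal{B})=\min_{B_i}\max_{A_i}\rho(A_nB_n\cdots A_1B_1).$$ Here each max (min) is taken over the whole collection $A_1,\ldots,A_n$ (respectively $B_1,\ldots,B_n$) at once. Define $$\mu(\mathcal{A},\mathcal{B})=\lim_{n\to\infty}\mu_n(\mathcal{A},\mathcal{B})^{1/n},\qquad \eta(\mathcal{A},\mathcal{B})=\lim_{n\to\infty}\eta_n(\mathcal{A},\mathcal{B})^{1/n}$$ (these limits exist and do not depend on the norm), and $$\hat{\mu}(\mathcal{A},\mathcal{B})=\limsup_{n\to\infty}\bar{\mu}_n(\mathcal{A},\mathcal{B})^{1/n},\quad \hat{\eta}(\mathcal{A},\mathcal{B})=\limsup_{n\to\infty}\bar{\eta}_n(\mathcal{A},\mathcal{B})^{1/n},$$ $$\check{\mu}(\mathcal{A},\mathcal{B})=\liminf_{n\to\infty}\bar{\mu}_n(\mathcal{A},\mathcal{B})^{1/n},\quad \check{\eta}(\mathcal{A},\mathcal{B})=\liminf_{n\to\infty}\bar{\eta}_n(\mathcal{A},\mathcal{B})^{1/n}.$$ *)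

theory Defs
  imports "HOL-Analysis.Analysis"
begin

definition positive_vec :: "real^'n \<Rightarrow> bool" where
  "positive_vec u \<longleftrightarrow> (\<forall>i. 0 < u $ i)"

definition positive_mat :: "real^'m^'n \<Rightarrow> bool" where
  "positive_mat A \<longleftrightarrow> (\<forall>i j. 0 < A $ i $ j)"

text \<open>Hourglass sets of N-by-M matrices, where N and M are the cardinalities of the index types
  \<open>'n\<close> and \<open>'m\<close>. The library order on \<open>real^'n\<close> is the coordinatewise one.\<close>

definition H_set :: "(real^'m^'n) set \<Rightarrow> bool" where
  "H_set \<A> \<longleftrightarrow>
     (\<forall>A\<in>\<A>. positive_mat A) \<and>
     (\<forall>At\<in>\<A>. \<forall>u. positive_vec u \<longrightarrow>
        ((\<forall>A\<in>\<A>. A *v u \<ge> At *v u) \<or> (\<exists>Ab\<in>\<A>. Ab *v u \<le> At *v u \<and> Ab *v u \<noteq> At *v u)) \<and>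
        ((\<forall>A\<in>\<A>. A *v u \<le> At *v u) \<or> (\<exists>Ab\<in>\<A>. Ab *v u \<ge> At *v u \<and> Ab *v u \<noteq> At *v u)))"

text \<open>Eigenvalues of a real square matrix are taken over the complex numbers. There are finitely
  many and at least one, so the supremum below is a maximum.\<close>

definition eigenvalues :: "real^'n^'n \<Rightarrow> complex set" where
  "eigenvalues X = {z. \<exists>v. v \<noteq> 0 \<and> map_matrix complex_of_real X *v v = z *s v}"

definition spectral_radius :: "real^'n^'n \<Rightarrow> real" where
  "spectral_radius X = (SUP z\<in>eigenvalues X. cmod z)"

text \<open>An arbitrary norm on a real vector space; on matrices it need not be submultiplicative.\<close>

definition is_norm :: "('a::real_vector \<Rightarrow> real) \<Rightarrow> bool" where
  "is_norm \<nu> \<longleftrightarrow>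
     (\<forall>x. 0 \<le> \<nu> x) \<and>
     (\<forall>x. \<nu> x = 0 \<longleftrightarrow> x = 0) \<and>
     (\<forall>c x. \<nu> (c *\<^sub>R x) = \<bar>c\<bar> * \<nu> x) \<and>
     (\<forall>x y. \<nu> (x + y) \<le> \<nu> x + \<nu> y)"

primrec alt_prod :: "(nat \<Rightarrow> real^'m^'n) \<Rightarrow> (nat \<Rightarrow> real^'n^'m) \<Rightarrow> nat \<Rightarrow> real^'n^'n" where
  "alt_prod A B 0 = mat 1"
| "alt_prod A B (Suc n) = A (Suc n) ** B (Suc n) ** alt_prod A B n"

text \<open>An n-tuple of elements of \<open>\<A>\<close> is a function mapping \<open>{1..n}\<close> into \<open>\<A>\<close>; its values at other
  indices do not enter \<open>alt_prod A B n\<close>. Maxima and minima are written as suprema and infima of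
  sets of reals: for nonempty compact \<open>\<A>\<close> and \<open>\<B>\<close> they are attained, the norm and the spectral
  radius being continuous. The functional \<open>\<phi>\<close> is a norm or the spectral radius.\<close>

definition maxmin :: "(real^'n^'n \<Rightarrow> real) \<Rightarrow> (real^'m^'n) set \<Rightarrow> (real^'n^'m) set \<Rightarrow> nat \<Rightarrow> real" where
  "maxmin \<phi> \<A> \<B> n =
     (SUP A\<in>{1..n} \<rightarrow> \<A>. INF B\<in>{1..n} \<rightarrow> \<B>. \<phi> (alt_prod A B n))"

definition minmax :: "(real^'n^'n \<Rightarrow> real) \<Rightarrow> (real^'m^'n) set \<Rightarrow> (real^'n^'m) set \<Rightarrow> nat \<Rightarrow> real" where
  "minmax \<phi> \<A> \<B> n =
     (INF B\<in>{1..n} \<rightarrow> \<B>. SUP A\<in>{1..n} \<rightarrow> \<A>. \<phi> (alt_prod A B n))"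

definition mu_seq :: "(real^'n^'n \<Rightarrow> real) \<Rightarrow> (real^'m^'n) set \<Rightarrow> (real^'n^'m) set \<Rightarrow> nat \<Rightarrow> real" where
  "mu_seq \<nu> \<A> \<B> n = root n (maxmin \<nu> \<A> \<B> n)"

definition eta_seq :: "(real^'n^'n \<Rightarrow> real) \<Rightarrow> (real^'m^'n) set \<Rightarrow> (real^'n^'m) set \<Rightarrow> nat \<Rightarrow> real" where
  "eta_seq \<nu> \<A> \<B> n = root n (minmax \<nu> \<A> \<B> n)"

definition mu_bar_seq :: "(real^'m^'n) set \<Rightarrow> (real^'n^'m) set \<Rightarrow> nat \<Rightarrow> real" where
  "mu_bar_seq \<A> \<B> n = root n (maxmin spectral_radius \<A> \<B> n)"

definition eta_bar_seq :: "(real^'m^'n) set \<Rightarrow> (real^'n^'m) set \<Rightarrow> nat \<Rightarrow> real" where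
  "eta_bar_seq \<A> \<B> n = root n (minmax spectral_radius \<A> \<B> n)"

text \<open>\<open>lim\<close> is unspecified on divergent sequences, so uses of the next two constants should come
  with convergence of \<open>mu_seq\<close> and \<open>eta_seq\<close>.\<close>

definition mu :: "(real^'n^'n \<Rightarrow> real) \<Rightarrow> (real^'m^'n) set \<Rightarrow> (real^'n^'m) set \<Rightarrow> real" where
  "mu \<nu> \<A> \<B> = lim (mu_seq \<nu> \<A> \<B>)"

definition eta :: "(real^'n^'n \<Rightarrow> real) \<Rightarrow> (real^'m^'n) set \<Rightarrow> (real^'n^'m) set \<Rightarrow> real" where
  "eta \<nu> \<A> \<B> = lim (eta_seq \<nu> \<A> \<B>)"

definition mu_hat :: "(real^'m^'n) set \<Rightarrow> (real^'n^'m) set \<Rightarrow> ereal" where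
  "mu_hat \<A> \<B> = limsup (\<lambda>n. ereal (mu_bar_seq \<A> \<B> n))"

definition eta_hat :: "(real^'m^'n) set \<Rightarrow> (real^'n^'m) set \<Rightarrow> ereal" where
  "eta_hat \<A> \<B> = limsup (\<lambda>n. ereal (eta_bar_seq \<A> \<B> n))"

definition mu_check :: "(real^'m^'n) set \<Rightarrow> (real^'n^'m) set \<Rightarrow> ereal" where
  "mu_check \<A> \<B> = liminf (\<lambda>n. ereal (mu_bar_seq \<A> \<B> n))"

definition eta_check :: "(real^'m^'n) set \<Rightarrow> (real^'n^'m) set \<Rightarrow> ereal" where
  "eta_check \<A> \<B> = liminf (\<lambda>n. ereal (eta_bar_seq \<A> \<B> n))"

end

theory Submission
  imports Defs
begin

text \<open>For a positive vector \<open>v\<close>, compactness and the hourglass property provide one matrix of \<open>\<B>\<close> that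
  minimizes all coordinates of \<open>B v\<close> simultaneously, and likewise for maxima over \<open>\<A>\<close>. The
  map \<open>v \<mapsto> max\<^sub>A A (min\<^sub>B B v)\<close>, with coordinatewise extrema, is continuous and sends nonzero
  nonnegative vectors to positive ones, so Brouwer's theorem on the simplex gives it a positive
  eigenvector \<open>v\<close> with eigenvalue \<open>s > 0\<close>. If \<open>As\<close> and \<open>Bs\<close> attain the extrema at \<open>v\<close>, then playing \<open>As\<close>
  constantly forces every alternating product \<open>X\<close> of length \<open>n\<close> to satisfy \<open>X v \<ge> s\<^sup>n v\<close>, and playing \<open>Bs\<close>
  constantly forces \<open>X v \<le> s\<^sup>n v\<close>. Norms and the spectral radius of positive matrices are controlled, up
  to constant factors, by such inequalities, so all six quantities equal \<open>s\<close>.\<close>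

section \<open>Positive vectors and matrices\<close>

lemma positive_vec_nonneg: "positive_vec v \<Longrightarrow> 0 \<le> v"
  by (simp add: positive_vec_def less_eq_vec_def order_less_imp_le)

lemma positive_vec_nonzero: "positive_vec v \<Longrightarrow> v \<noteq> 0"
  by (auto simp: positive_vec_def)

lemma positive_mat_mono:
  assumes "positive_mat A" "x \<le> y"
  shows "A *v x \<le> A *v y"
  using assms
  by (auto simp: positive_mat_def less_eq_vec_def matrix_vector_mult_def order_less_imp_le
      intro!: sum_mono mult_left_mono)

lemma positive_mat_mult_vec:
  assumes "positive_mat A" "0 \<le> x" "x \<noteq> 0"
  shows "positive_vec (A *v x)"
proof -
  obtain j where "x $ j \<noteq> 0"
    using assms(3) by (auto simp: vec_eq_iff)
  then have j: "0 < x $ j"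
    using assms(2) by (simp add: less_eq_vec_def order_less_le)
  have "0 < (\<Sum>k\<in>UNIV. A $ i $ k * x $ k)" for i
  proof (rule sum_pos2[of UNIV j])
    show "0 < A $ i $ j * x $ j"
      using assms(1) j by (simp add: positive_mat_def)
    show "0 \<le> A $ i $ k * x $ k" for k
      using assms(1,2) by (simp add: positive_mat_def less_eq_vec_def order_less_imp_le)
  qed auto
  then show ?thesis
    by (simp add: positive_vec_def matrix_vector_mult_def)
qed

lemma positive_mat_mult:
  assumes "positive_mat A" "positive_mat B"
  shows "positive_mat (A ** B)"
  using assms by (auto simp: positive_mat_def matrix_matrix_mult_def intro!: sum_pos)

text \<open>The largest of the ratios \<open>u $ i / v $ i\<close> serves as \<open>t\<close>.
  Comparing \<open>u\<close> with \<open>t *\<^sub>R v\<close> at the tight coordinate turns vector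
  inequalities into scalar ones, which is how eigenvalues are compared below.\<close>

lemma obtain_tight_multiple:
  fixes u v :: "real^'n"
  assumes "positive_vec v"
  obtains t i where "u \<le> t *\<^sub>R v" "u $ i = t * v $ i"
proof -
  define R where "R = range (\<lambda>i. u $ i / v $ i)"
  have v: "0 < v $ i" for i
    using assms by (simp add: positive_vec_def)
  have "Max R \<in> range (\<lambda>i. u $ i / v $ i)"
    unfolding R_def[symmetric] by (rule Max_in) (auto simp: R_def)
  then obtain i where i: "Max R = u $ i / v $ i"
    by blast
  have "u $ j / v $ j \<le> Max R" for j
    unfolding R_def by (rule Max_ge) auto
  then have "u \<le> Max R *\<^sub>R v"
    using v by (simp add: less_eq_vec_def pos_divide_le_eq)
  moreover have "u $ i = Max R * v $ i"
    using v[of i] unfolding i by simp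
  ultimately show thesis
    by (rule that)
qed

section \<open>Positive eigenvectors from Brouwer's theorem\<close>

text \<open>Dividing \<open>F\<close> by its coordinate sum gives a continuous self-map of the
  standard simplex, and a Brouwer fixed point of it is an eigenvector of \<open>F\<close>. The lemma
  serves twice: for linear maps, giving Perron eigenvectors, and for the nonlinear saddle
  map.\<close>

lemma positive_map_eigenvector:
  fixes F :: "real^'n \<Rightarrow> real^'n"
  assumes cont: "continuous_on UNIV F"
    and pos: "\<And>x. 0 \<le> x \<Longrightarrow> x \<noteq> 0 \<Longrightarrow> positive_vec (F x)"
  obtains v s where "positive_vec v" "0 < s" "F v = s *\<^sub>R v"
proof -
  define S :: "(real^'n) set" where "S = {x. (\<forall>i. 0 \<le> x $ i) \<and> (\<Sum>i\<in>UNIV. x $ i) = 1}"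
  have S: "0 \<le> x" "x \<noteq> 0" if "x \<in> S" for x
    using that by (auto simp: S_def less_eq_vec_def)
  have Fpos: "0 < F x $ i" if "x \<in> S" for x i
    using pos[OF S[OF that]] by (simp add: positive_vec_def)
  have sumpos: "0 < (\<Sum>i\<in>UNIV. F x $ i)" if "x \<in> S" for x
    using Fpos[OF that] by (intro sum_pos) auto
  define G where "G = (\<lambda>x. (1 / (\<Sum>i\<in>UNIV. F x $ i)) *\<^sub>R F x)"
  have "closed S"
    unfolding S_def by (intro closed_Collect_conj closed_Collect_all closed_Collect_le
        closed_Collect_eq continuous_intros)
  moreover have "norm x \<le> 1" if "x \<in> S" for x
    using norm_le_l1_cart[of x] that by (simp add: S_def)
  then have "bounded S"
    by (auto simp: bounded_iff)
  ultimately have "compact S"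
    by (simp add: compact_eq_bounded_closed)
  moreover have "convex S"
    unfolding convex_def
    by (auto simp: S_def sum.distrib sum_distrib_left[symmetric])
  moreover have "axis k 1 \<in> S" for k
    by (auto simp: S_def axis_def)
  then have "S \<noteq> {}"
    by blast
  moreover have "continuous_on S G"
    unfolding G_def using sumpos
    by (intro continuous_intros continuous_on_subset[OF cont]) (auto simp: less_imp_neq[symmetric])
  moreover have "G x \<in> S" if "x \<in> S" for x
    using Fpos[OF that] sumpos[OF that]
    by (auto simp: S_def G_def sum_divide_distrib[symmetric] order_less_imp_le)
  then have "G \<in> S \<rightarrow> S"
    by blast
  ultimately obtain v where v: "v \<in> S" "G v = v"
    using brouwer by blast
  let ?s = "\<Sum>i\<in>UNIV. F v $ i"
  have "F v = ?s *\<^sub>R G v"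
    using sumpos[OF v(1)] by (simp add: G_def)
  then have F: "F v = ?s *\<^sub>R v"
    by (simp only: v(2))
  \<comment> \<open>Membership in the simplex only makes \<open>v\<close> nonnegative; strict
    positivity is inherited from \<open>F v\<close>.\<close>
  have "0 < (?s *\<^sub>R v) $ i" for i
    by (simp only: F[symmetric] Fpos[OF v(1)])
  then have "positive_vec v"
    using sumpos[OF v(1)] by (simp add: positive_vec_def zero_less_mult_iff)
  then show thesis
    using that sumpos[OF v(1)] F by blast
qed

section \<open>Collatz-Wielandt bounds for the spectral radius\<close>

text \<open>The moduli \<open>w\<close> of the coordinates of an eigenvector satisfy
  \<open>cmod z * w $ i \<le> (X *v w) $ i\<close>. If \<open>t *\<^sub>R v\<close> dominates
  \<open>w\<close> and is tight at \<open>i\<close>, monotonicity of \<open>X\<close> bounds the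
  right side by \<open>r * w $ i\<close>, and \<open>w $ i\<close> cancels.\<close>

lemma eigenvalue_le:
  assumes X: "positive_mat X" and v: "positive_vec v" and le: "X *v v \<le> r *\<^sub>R v"
    and z: "z \<in> eigenvalues X"
  shows "cmod z \<le> r"
proof -
  obtain u where u: "u \<noteq> 0" "map_matrix complex_of_real X *v u = z *s u"
    using z by (auto simp: eigenvalues_def)
  define w where "w = (\<chi> i. cmod (u $ i))"
  obtain t i where t: "w \<le> t *\<^sub>R v" "w $ i = t * v $ i"
    by (rule obtain_tight_multiple[OF v])
  have vpos: "0 < v $ j" for j
    using v by (simp add: positive_vec_def)
  \<comment> \<open>A nonzero coordinate of \<open>u\<close> forces \<open>t\<close> to be positive,
    so that the tight coordinate of \<open>w\<close> is positive and may be cancelled at the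
    end.\<close>
  obtain j where j: "u $ j \<noteq> 0"
    using u(1) by (auto simp: vec_eq_iff)
  have "w $ j \<le> t * v $ j"
    using t(1) by (simp add: less_eq_vec_def)
  then have "0 < t * v $ j"
    using j by (simp add: w_def order_less_le_trans[of 0 "cmod (u $ j)"])
  then have "0 < t"
    using vpos[of j] by (simp add: zero_less_mult_iff)
  have "cmod z * w $ i = cmod ((z *s u) $ i)"
    by (simp add: w_def norm_mult)
  also have "\<dots> = cmod (\<Sum>k\<in>UNIV. complex_of_real (X $ i $ k) * u $ k)"
    by (simp add: u(2)[symmetric] matrix_vector_mult_def map_matrix_def)
  also have "\<dots> \<le> (\<Sum>k\<in>UNIV. X $ i $ k * w $ k)"
    using X by (intro sum_norm_le) (simp add: norm_mult w_def positive_mat_def order_less_imp_le)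
  also have "\<dots> = (X *v w) $ i"
    by (simp add: matrix_vector_mult_def)
  also have "\<dots> \<le> (X *v (t *\<^sub>R v)) $ i"
    using positive_mat_mono[OF X t(1)] by (simp add: less_eq_vec_def)
  also have "\<dots> = t * (X *v v) $ i"
    by (simp add: matrix_vector_mult_scaleR)
  also have "\<dots> \<le> t * (r * v $ i)"
    using le \<open>0 < t\<close> by (simp add: less_eq_vec_def)
  also have "\<dots> = r * w $ i"
    by (simp add: t(2))
  finally show ?thesis
    using t(2) \<open>0 < t\<close> vpos[of i] by simp
qed

text \<open>Brouwer supplies a real eigenpair; embedding the eigenvector coordinatewise into the
  complex numbers places its eigenvalue in \<open>eigenvalues X\<close>.\<close>

lemma obtain_Perron_eigenvalue:
  assumes X: "positive_mat X"
  obtains x s where "positive_vec x" "0 < s" "X *v x = s *\<^sub>R x" "complex_of_real s \<in> eigenvalues X"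
proof -
  obtain x s where x: "positive_vec x" "0 < s" "X *v x = s *\<^sub>R x"
    by (rule positive_map_eigenvector[OF _ positive_mat_mult_vec[OF X]])
      (auto intro: linear_continuous_on matrix_vector_mul_bounded_linear)
  have "map_matrix complex_of_real X *v (\<chi> i. complex_of_real (x $ i))
      = (\<chi> i. complex_of_real ((X *v x) $ i))"
    by (simp add: vec_eq_iff matrix_vector_mult_def map_matrix_def)
  also have "\<dots> = complex_of_real s *s (\<chi> i. complex_of_real (x $ i))"
    by (simp add: x(3) vec_eq_iff)
  finally have "map_matrix complex_of_real X *v (\<chi> i. complex_of_real (x $ i))
      = complex_of_real s *s (\<chi> i. complex_of_real (x $ i))" .
  moreover have "(\<chi> i. complex_of_real (x $ i)) \<noteq> 0"
    using positive_vec_nonzero[OF x(1)] by (simp add: vec_eq_iff)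
  ultimately have "complex_of_real s \<in> eigenvalues X"
    unfolding eigenvalues_def by blast
  with x show thesis
    by (rule that)
qed

text \<open>The Perron eigenvalue is used only to know that the supremum ranges over a nonempty
  set.\<close>

lemma spectral_radius_le:
  assumes "positive_mat X" "positive_vec v" "X *v v \<le> r *\<^sub>R v"
  shows "spectral_radius X \<le> r"
  unfolding spectral_radius_def
  using obtain_Perron_eigenvalue[OF assms(1)] eigenvalue_le[OF assms]
  by (intro cSUP_least) blast+

text \<open>Comparing \<open>v\<close> with a tight multiple of the Perron eigenvector
  \<open>x\<close> gives \<open>r \<le> s\<close>. Applied to \<open>x\<close> itself,
  \<open>eigenvalue_le\<close> shows that the moduli of the eigenvalues are bounded above, so the
  supremum is at least \<open>s\<close>.\<close>

lemma spectral_radius_ge: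
  assumes X: "positive_mat X" and v: "positive_vec v" and ge: "r *\<^sub>R v \<le> X *v v"
  shows "r \<le> spectral_radius X"
proof -
  obtain x s where x: "positive_vec x" "0 < s" "X *v x = s *\<^sub>R x"
      "complex_of_real s \<in> eigenvalues X"
    by (rule obtain_Perron_eigenvalue[OF X])
  obtain t i where t: "v \<le> t *\<^sub>R x" "v $ i = t * x $ i"
    by (rule obtain_tight_multiple[OF x(1)])
  have "r * v $ i \<le> (X *v v) $ i"
    using ge by (simp add: less_eq_vec_def)
  also have "\<dots> \<le> (X *v (t *\<^sub>R x)) $ i"
    using positive_mat_mono[OF X t(1)] by (simp add: less_eq_vec_def)
  also have "\<dots> = s * v $ i"
    by (simp add: matrix_vector_mult_scaleR x(3) t(2))
  finally have "r \<le> s"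
    using v by (simp add: positive_vec_def)
  also have "s = cmod (complex_of_real s)"
    using x(2) by simp
  also have "\<dots> \<le> spectral_radius X"
    unfolding spectral_radius_def
    using eigenvalue_le[OF X x(1)] x(3)
    by (intro cSUP_upper x(4) bdd_aboveI2[of _ _ s]) auto
  finally show ?thesis .
qed

section \<open>Norms and growth along a positive vector\<close>

text \<open>Expanding in the basis gives the upper constant, and with it the Lipschitz continuity of
  \<open>\<nu>\<close>. The lower constant is the minimum of \<open>\<nu>\<close> on the compact
  unit sphere, carried to all vectors by homogeneity.\<close>

lemma is_norm_equivalent:
  fixes \<nu> :: "'a::euclidean_space \<Rightarrow> real"
  assumes "is_norm \<nu>"
  obtains c C where "0 < c" "0 < C" "\<And>x. c * norm x \<le> \<nu> x" "\<And>x. \<nu> x \<le> C * norm x"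
proof -
  have nn: "0 \<le> \<nu> x" and zero: "\<nu> x = 0 \<longleftrightarrow> x = 0" and scale: "\<nu> (a *\<^sub>R x) = \<bar>a\<bar> * \<nu> x"
    and tri: "\<nu> (x + y) \<le> \<nu> x + \<nu> y" for x y a
    using assms by (auto simp: is_norm_def)
  define C where "C = 1 + (\<Sum>b\<in>Basis. \<nu> b)"
  have "0 < C"
    unfolding C_def by (intro add_pos_nonneg sum_nonneg nn) simp
  have tri_sum: "\<nu> (\<Sum>b\<in>T. f b) \<le> (\<Sum>b\<in>T. \<nu> (f b))" if "finite T" for T and f :: "'a \<Rightarrow> 'a"
    using that
  proof induction
    case empty
    then show ?case using zero[of 0] by simp
  next
    case (insert b T)
    then show ?case using tri[of "f b" "sum f T"] by simp
  qed
  have upper: "\<nu> x \<le> C * norm x" for x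
  proof -
    have "\<nu> x = \<nu> (\<Sum>b\<in>Basis. (x \<bullet> b) *\<^sub>R b)"
      by (simp add: euclidean_representation)
    also have "\<dots> \<le> (\<Sum>b\<in>Basis. \<bar>x \<bullet> b\<bar> * \<nu> b)"
      using tri_sum[of Basis "\<lambda>b. (x \<bullet> b) *\<^sub>R b"] by (simp add: scale)
    also have "\<dots> \<le> (\<Sum>b\<in>Basis. norm x * \<nu> b)"
      by (intro sum_mono mult_right_mono nn Basis_le_norm)
    also have "\<dots> \<le> C * norm x"
      by (simp add: C_def sum_distrib_left[symmetric] algebra_simps)
    finally show ?thesis .
  qed
  have lip: "\<nu> x - \<nu> y \<le> C * norm (x - y)" for x y
    using tri[of "x - y" y] upper[of "x - y"] by simp
  have abs_lip: "\<bar>\<nu> x - \<nu> y\<bar> \<le> C * norm (x - y)" for x y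
    using lip[of x y] lip[of y x] by (simp add: abs_le_iff norm_minus_commute)
  have "C-lipschitz_on UNIV \<nu>"
    using abs_lip \<open>0 < C\<close>
    by (intro lipschitz_onI) (auto simp: dist_norm dist_real_def)
  then have "continuous_on (sphere 0 1) \<nu>"
    by (meson continuous_on_subset lipschitz_on_continuous_on subset_UNIV)
  moreover obtain b :: 'a where "b \<in> Basis"
    using nonempty_Basis by blast
  then have "sphere (0::'a) 1 \<noteq> {}"
    by (auto intro!: exI[of _ b])
  ultimately obtain e where e: "e \<in> sphere 0 1" "\<And>y. y \<in> sphere 0 1 \<Longrightarrow> \<nu> e \<le> \<nu> y"
    using continuous_attains_inf[of "sphere 0 1" \<nu>] by auto
  have "\<nu> e * norm x \<le> \<nu> x" for x
  proof (cases "x = 0")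
    case False
    then have "\<nu> e \<le> \<nu> ((1 / norm x) *\<^sub>R x)"
      by (intro e(2)) simp
    then show ?thesis
      using False by (simp only: scale) (simp add: field_simps)
  qed (simp add: nn)
  moreover have "0 < \<nu> e"
    using e(1) nn[of e] zero[of e] by (auto simp: order_less_le)
  ultimately show thesis
    using that \<open>0 < C\<close> upper by blast
qed

text \<open>Cauchy-Schwarz applied to row \<open>i\<close> of \<open>X\<close> and
  \<open>v\<close>.\<close>

lemma norm_ge_of_growth:
  fixes X :: "real^'n^'n"
  assumes v: "positive_vec v" and "0 \<le> r" "r *\<^sub>R v \<le> X *v v"
  shows "r * (v $ i / norm v) \<le> norm X"
proof -
  have "r * v $ i \<le> (X *v v) $ i"
    using assms(3) by (simp add: less_eq_vec_def)
  also have "\<dots> \<le> norm (X $ i) * norm v"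
    by (simp add: matrix_vector_mul_component norm_cauchy_schwarz)
  also have "\<dots> \<le> norm X * norm v"
    by (intro mult_right_mono Finite_Cartesian_Product.norm_nth_le) simp
  finally show ?thesis
    using positive_vec_nonzero[OF v] by (simp add: pos_divide_le_eq)
qed

text \<open>No cancellation occurs in \<open>X *v v\<close>, so each single term
  \<open>X $ i $ j * v $ j\<close> is at most \<open>r * v $ i\<close>. This bounds every entry, and
  the norm is at most the sum of the absolute values of the entries.\<close>

lemma norm_le_of_growth:
  fixes X :: "real^'n^'n"
  assumes X: "positive_mat X" and v: "positive_vec v" and le: "X *v v \<le> r *\<^sub>R v"
  shows "norm X \<le> (\<Sum>i\<in>UNIV. \<Sum>j\<in>UNIV. v $ i / v $ j) * r"
proof -
  have pos: "0 < v $ i" "0 < X $ i $ j" for i j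
    using X v by (auto simp: positive_vec_def positive_mat_def)
  have entry: "X $ i $ j \<le> v $ i / v $ j * r" for i j
  proof -
    have "X $ i $ j * v $ j \<le> (\<Sum>k\<in>UNIV. X $ i $ k * v $ k)"
      using pos by (intro member_le_sum) (auto simp: order_less_imp_le)
    also have "\<dots> \<le> r * v $ i"
      using le by (simp add: less_eq_vec_def matrix_vector_mult_def)
    finally show ?thesis
      using pos(1)[of j] by (simp add: field_simps)
  qed
  have "norm X \<le> (\<Sum>i\<in>UNIV. norm (X $ i))"
    by (simp add: norm_vec_def L2_set_le_sum)
  also have "\<dots> \<le> (\<Sum>i\<in>UNIV. \<Sum>j\<in>UNIV. \<bar>X $ i $ j\<bar>)"
    by (intro sum_mono norm_le_l1_cart)
  also have "\<dots> \<le> (\<Sum>i\<in>UNIV. \<Sum>j\<in>UNIV. v $ i / v $ j * r)"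
    using pos(2) entry by (intro sum_mono) (simp add: abs_of_pos)
  finally show ?thesis
    by (simp add: sum_distrib_right)
qed

section \<open>Coordinatewise extrema over compact sets of matrices\<close>

text \<open>A finite supremum of linear functionals is convex, and a finite convex function on a
  whole Euclidean space is continuous. Compactness of \<open>K\<close> keeps the supremum
  finite.\<close>

lemma continuous_support_function:
  fixes K :: "'a::euclidean_space set"
  assumes "compact K" "K \<noteq> {}"
  shows "continuous_on UNIV (\<lambda>x. SUP a\<in>K. a \<bullet> x)"
proof -
  have bdd: "bdd_above ((\<lambda>a. a \<bullet> x) ` K)" for x
    using assms(1)
    by (intro bounded_imp_bdd_above compact_imp_bounded compact_continuous_image continuous_intros)
  have "convex_on UNIV (\<lambda>x. SUP a\<in>K. a \<bullet> x)"
  proof (rule convex_onI)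
    fix t :: real and x y :: 'a
    assume t: "0 < t" "t < 1"
    show "(SUP a\<in>K. a \<bullet> ((1 - t) *\<^sub>R x + t *\<^sub>R y))
        \<le> (1 - t) * (SUP a\<in>K. a \<bullet> x) + t * (SUP a\<in>K. a \<bullet> y)"
    proof (rule cSUP_least[OF assms(2)])
      fix a assume "a \<in> K"
      then have "a \<bullet> x \<le> (SUP a\<in>K. a \<bullet> x)" "a \<bullet> y \<le> (SUP a\<in>K. a \<bullet> y)"
        by (auto intro: cSUP_upper bdd)
      then have "(1 - t) * (a \<bullet> x) + t * (a \<bullet> y)
          \<le> (1 - t) * (SUP a\<in>K. a \<bullet> x) + t * (SUP a\<in>K. a \<bullet> y)"
        using t by (intro add_mono mult_left_mono) auto
      then show "a \<bullet> ((1 - t) *\<^sub>R x + t *\<^sub>R y)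
          \<le> (1 - t) * (SUP a\<in>K. a \<bullet> x) + t * (SUP a\<in>K. a \<bullet> y)"
        by (simp add: inner_add_right)
    qed
  qed simp
  then show ?thesis
    by (intro convex_on_continuous) auto
qed

text \<open>Different coordinates may be attained by different matrices. For a hourglass set and a
  positive \<open>x\<close> one matrix attains them all, but continuity and positivity hold without
  that.\<close>

definition sup_env :: "(real^'m^'n) set \<Rightarrow> real^'m \<Rightarrow> real^'n" where
  "sup_env \<A> x = (\<chi> i. SUP A\<in>\<A>. (A *v x) $ i)"

text \<open>Written through negation so that continuity and attainment carry over from
  \<open>sup_env\<close>.\<close>

definition inf_env :: "(real^'m^'n) set \<Rightarrow> real^'m \<Rightarrow> real^'n" where
  "inf_env \<A> x = - sup_env (uminus ` \<A>) x"

lemma continuous_sup_env: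
  fixes \<A> :: "(real^'m^'n) set"
  assumes "compact \<A>" "\<A> \<noteq> {}"
  shows "continuous_on UNIV (sup_env \<A>)"
proof -
  have "continuous_on UNIV (\<lambda>x. SUP A\<in>\<A>. (A *v x) $ i)" for i
  proof -
    \<comment> \<open>Coordinate \<open>i\<close> of \<open>sup_env\<close> is the support function
      of the set of \<open>i\<close>-th rows.\<close>
    have "compact ((\<lambda>A. A $ i) ` \<A>)"
      by (intro compact_continuous_image assms continuous_intros)
    from continuous_support_function[OF this] show ?thesis
      using assms(2) by (simp add: image_image matrix_vector_mul_component)
  qed
  then show ?thesis
    unfolding sup_env_def by (rule continuous_on_vec_lambda)
qed

lemma continuous_inf_env:
  fixes \<A> :: "(real^'m^'n) set"
  assumes "compact \<A>" "\<A> \<noteq> {}"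
  shows "continuous_on UNIV (inf_env \<A>)"
  unfolding inf_env_def using assms
  by (intro continuous_on_minus continuous_sup_env compact_negations) auto

lemma continuous_matrix_vector_entry:
  fixes x :: "real^'m"
  shows "continuous_on S (\<lambda>A::real^'m^'n. (A *v x) $ i)"
  by (simp add: matrix_vector_mul_component) (intro continuous_intros)

lemma sup_env_attained:
  fixes \<A> :: "(real^'m^'n) set"
  assumes "compact \<A>" "\<A> \<noteq> {}"
  shows "\<exists>A\<in>\<A>. sup_env \<A> x $ i = (A *v x) $ i"
proof -
  obtain A where A: "A \<in> \<A>" "\<And>A'. A' \<in> \<A> \<Longrightarrow> (A' *v x) $ i \<le> (A *v x) $ i"
    using continuous_attains_sup[OF assms continuous_matrix_vector_entry] by metis
  have "(SUP A\<in>\<A>. (A *v x) $ i) = (A *v x) $ i"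
    using A by (intro cSup_eq_maximum) auto
  then show ?thesis
    using A(1) by (auto simp: sup_env_def)
qed

lemma uminus_matrix_vector_mult: "(- A) *v x = - (A *v (x :: real^'m))"
  by (simp add: vec_eq_iff matrix_vector_mult_def sum_negf)

lemma inf_env_attained:
  fixes \<A> :: "(real^'m^'n) set"
  assumes "compact \<A>" "\<A> \<noteq> {}"
  shows "\<exists>A\<in>\<A>. inf_env \<A> x $ i = (A *v x) $ i"
  using sup_env_attained[of "uminus ` \<A>" x i] assms compact_negations[OF assms(1)]
  by (auto simp: inf_env_def uminus_matrix_vector_mult)

lemma sup_env_upper:
  fixes \<A> :: "(real^'m^'n) set"
  assumes "compact \<A>" "A \<in> \<A>"
  shows "A *v x \<le> sup_env \<A> x"
  unfolding less_eq_vec_def sup_env_def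
  using assms
  by (auto intro!: cSUP_upper bounded_imp_bdd_above compact_imp_bounded compact_continuous_image
      continuous_matrix_vector_entry)

lemma positive_sup_env:
  assumes "compact \<A>" "\<A> \<noteq> {}" "\<And>A. A \<in> \<A> \<Longrightarrow> positive_mat A" "0 \<le> x" "x \<noteq> 0"
  shows "positive_vec (sup_env \<A> x)"
  using sup_env_attained[OF assms(1,2)] positive_mat_mult_vec[OF assms(3-5)]
  unfolding positive_vec_def by metis

lemma positive_inf_env:
  assumes "compact \<A>" "\<A> \<noteq> {}" "\<And>A. A \<in> \<A> \<Longrightarrow> positive_mat A" "0 \<le> x" "x \<noteq> 0"
  shows "positive_vec (inf_env \<A> x)"
  using inf_env_attained[OF assms(1,2)] positive_mat_mult_vec[OF assms(3-5)]
  unfolding positive_vec_def by metis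

section \<open>Hourglass sets and the saddle eigenvector\<close>

lemma sum_component_strict_mono:
  fixes x y :: "real^'n"
  assumes "x \<le> y" "x \<noteq> y"
  shows "(\<Sum>i\<in>UNIV. x $ i) < (\<Sum>i\<in>UNIV. y $ i)"
proof (rule sum_strict_mono_ex1)
  show "\<exists>i\<in>UNIV. x $ i < y $ i"
    using assms by (metis UNIV_I less_eq_vec_def order_less_le vec_eq_iff)
qed (use assms(1) in \<open>auto simp: less_eq_vec_def\<close>)

text \<open>A matrix maximizing the coordinate sum of \<open>A *v u\<close> exists by compactness.
  Nothing can dominate its image properly, since that would increase the sum; this excludes the
  second alternative of the hourglass condition. The minimizer is obtained dually.\<close>

lemma H_set_maximizer:
  fixes \<A> :: "(real^'m^'n) set"
  assumes "compact \<A>" "\<A> \<noteq> {}" "H_set \<A>" "positive_vec u"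
  obtains A where "A \<in> \<A>" "\<And>A'. A' \<in> \<A> \<Longrightarrow> A' *v u \<le> A *v u"
proof -
  have "continuous_on \<A> (\<lambda>A. \<Sum>i\<in>UNIV. (A *v u) $ i)"
    by (intro continuous_on_sum continuous_matrix_vector_entry)
  from continuous_attains_sup[OF assms(1,2) this] obtain A where A: "A \<in> \<A>"
    "\<And>A'. A' \<in> \<A> \<Longrightarrow> (\<Sum>i\<in>UNIV. (A' *v u) $ i) \<le> (\<Sum>i\<in>UNIV. (A *v u) $ i)"
    by blast
  have False if A': "A' \<in> \<A>" "A *v u \<le> A' *v u" "A' *v u \<noteq> A *v u" for A'
    using sum_component_strict_mono[OF A'(2) A'(3)[symmetric]] A(2)[OF A'(1)] by simp
  with A(1) assms(3,4) have "\<forall>A'\<in>\<A>. A' *v u \<le> A *v u"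
    unfolding H_set_def by blast
  with A(1) that show thesis
    by blast
qed

lemma H_set_minimizer:
  fixes \<A> :: "(real^'m^'n) set"
  assumes "compact \<A>" "\<A> \<noteq> {}" "H_set \<A>" "positive_vec u"
  obtains A where "A \<in> \<A>" "\<And>A'. A' \<in> \<A> \<Longrightarrow> A *v u \<le> A' *v u"
proof -
  have "continuous_on \<A> (\<lambda>A. \<Sum>i\<in>UNIV. (A *v u) $ i)"
    by (intro continuous_on_sum continuous_matrix_vector_entry)
  from continuous_attains_inf[OF assms(1,2) this] obtain A where A: "A \<in> \<A>"
    "\<And>A'. A' \<in> \<A> \<Longrightarrow> (\<Sum>i\<in>UNIV. (A *v u) $ i) \<le> (\<Sum>i\<in>UNIV. (A' *v u) $ i)"
    by blast
  have False if A': "A' \<in> \<A>" "A' *v u \<le> A *v u" "A' *v u \<noteq> A *v u" for A'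
    using sum_component_strict_mono[OF A'(2,3)] A(2)[OF A'(1)] by simp
  with A(1) assms(3,4) have "\<forall>A'\<in>\<A>. A *v u \<le> A' *v u"
    unfolding H_set_def by blast
  with A(1) that show thesis
    by blast
qed

lemma sup_env_eq:
  assumes "compact \<A>" "A \<in> \<A>" "\<And>A'. A' \<in> \<A> \<Longrightarrow> A' *v x \<le> A *v x"
  shows "sup_env \<A> x = A *v x"
  using sup_env_attained[of \<A> x] sup_env_upper[OF assms(1,2), of x] assms
  by (metis empty_iff less_eq_vec_def order_antisym vec_eq_iff)

lemma inf_env_eq:
  assumes "compact \<A>" "A \<in> \<A>" "\<And>A'. A' \<in> \<A> \<Longrightarrow> A *v x \<le> A' *v x"
  shows "inf_env \<A> x = A *v x"
proof -
  have "sup_env (uminus ` \<A>) x = (- A) *v x"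
    using assms by (intro sup_env_eq compact_negations) (auto simp: uminus_matrix_vector_mult)
  then show ?thesis
    by (simp add: inf_env_def uminus_matrix_vector_mult)
qed

lemma saddle_eigenvector:
  fixes \<A> :: "(real^'m^'n) set" and \<B> :: "(real^'n^'m) set"
  assumes \<A>: "\<A> \<noteq> {}" "compact \<A>" "H_set \<A>"
    and \<B>: "\<B> \<noteq> {}" "compact \<B>" "H_set \<B>"
  obtains v s As Bs where "positive_vec v" "0 < s" "As \<in> \<A>" "Bs \<in> \<B>"
    "\<And>A. A \<in> \<A> \<Longrightarrow> A *v (Bs *v v) \<le> s *\<^sub>R v"
    "\<And>B. B \<in> \<B> \<Longrightarrow> s *\<^sub>R v \<le> As *v (B *v v)"
proof -
  have pos: "\<And>A. A \<in> \<A> \<Longrightarrow> positive_mat A" "\<And>B. B \<in> \<B> \<Longrightarrow> positive_mat B"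
    using \<A>(3) \<B>(3) by (auto simp: H_set_def)
  define F where "F = (\<lambda>v. sup_env \<A> (inf_env \<B> v))"
  have "continuous_on UNIV F"
    unfolding F_def
    by (rule continuous_on_compose2[OF continuous_sup_env[OF \<A>(2,1)] continuous_inf_env[OF \<B>(2,1)]])
      simp
  moreover have "positive_vec (F x)" if "0 \<le> x" "x \<noteq> 0" for x
  proof -
    have "positive_vec (inf_env \<B> x)"
      using \<B>(1,2) pos that by (intro positive_inf_env) auto
    then show ?thesis
      unfolding F_def using \<A>(1,2) pos
      by (intro positive_sup_env) (auto intro: positive_vec_nonneg dest: positive_vec_nonzero)
  qed
  ultimately obtain v s where v: "positive_vec v" "0 < s" "F v = s *\<^sub>R v"
    by (rule positive_map_eigenvector)
  obtain Bs where Bs: "Bs \<in> \<B>" "\<And>B. B \<in> \<B> \<Longrightarrow> Bs *v v \<le> B *v v"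
    using H_set_minimizer[OF \<B>(2,1,3) v(1)] by blast
  \<comment> \<open>The hourglass condition on \<open>\<A>\<close> speaks about positive vectors
    only, so this is what allows a simultaneous maximizer at \<open>Bs *v v\<close>.\<close>
  have "positive_vec (Bs *v v)"
    by (rule positive_mat_mult_vec[OF pos(2)[OF Bs(1)] positive_vec_nonneg[OF v(1)]
          positive_vec_nonzero[OF v(1)]])
  from H_set_maximizer[OF \<A>(2,1,3) this] obtain As where
    As: "As \<in> \<A>" "\<And>A. A \<in> \<A> \<Longrightarrow> A *v (Bs *v v) \<le> As *v (Bs *v v)"
    by blast
  have eq: "As *v (Bs *v v) = s *\<^sub>R v"
    using v(3) unfolding F_def
    by (simp add: inf_env_eq[OF \<B>(2) Bs] sup_env_eq[OF \<A>(2) As])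
  \<comment> \<open>\<open>As\<close> is optimal against \<open>Bs\<close> only; any other
    \<open>B\<close> gives a larger \<open>B *v v\<close>, and the positive matrix \<open>As\<close>
    preserves the order.\<close>
  have "s *\<^sub>R v \<le> As *v (B *v v)" if "B \<in> \<B>" for B
    unfolding eq[symmetric] using pos(1)[OF As(1)] Bs(2)[OF that] by (rule positive_mat_mono)
  with v As Bs eq show thesis
    by (intro that) auto
qed

section \<open>Growth of alternating products and bounds on game values\<close>

text \<open>The empty product is the identity, which has zero entries in dimension above one. Hence
  \<open>0 < n\<close>, and the step splits off the product of length one.\<close>

lemma positive_alt_prod:
  assumes "\<And>k. k \<in> {1..n} \<Longrightarrow> positive_mat (A k)" "\<And>k. k \<in> {1..n} \<Longrightarrow> positive_mat (B k)" "0 < n"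
  shows "positive_mat (alt_prod A B n)"
  using assms
proof (induction n)
  case (Suc n)
  have "positive_mat (A (Suc n) ** B (Suc n))"
    using Suc.prems by (intro positive_mat_mult) auto
  then show ?case
    using Suc by (cases "n = 0") (auto intro: positive_mat_mult)
qed simp

text \<open>Used with \<open>r = s\<close> when the second player repeats \<open>Bs\<close>, and
  with a cruder \<open>r\<close> for arbitrary choices of both players.\<close>

lemma alt_prod_le:
  assumes "\<And>k. k \<in> {1..n} \<Longrightarrow> positive_mat (A k)" "\<And>k. k \<in> {1..n} \<Longrightarrow> positive_mat (B k)"
    and "\<And>k. k \<in> {1..n} \<Longrightarrow> A k *v (B k *v v) \<le> r *\<^sub>R v" "0 \<le> r"
  shows "alt_prod A B n *v v \<le> (r ^ n) *\<^sub>R v"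
  using assms
proof (induction n)
  case (Suc n)
  let ?A = "A (Suc n)" and ?B = "B (Suc n)"
  have "?A *v (?B *v (alt_prod A B n *v v)) \<le> ?A *v (?B *v ((r ^ n) *\<^sub>R v))"
    using Suc by (intro positive_mat_mono) auto
  also have "\<dots> = (r ^ n) *\<^sub>R (?A *v (?B *v v))"
    by (simp add: matrix_vector_mult_scaleR)
  also have "\<dots> \<le> (r ^ n) *\<^sub>R (r *\<^sub>R v)"
    using Suc.prems(3)[of "Suc n"] \<open>0 \<le> r\<close>
    by (auto simp: less_eq_vec_def mult.assoc intro!: mult_left_mono)
  finally show ?case
    by (simp add: matrix_vector_mul_assoc[symmetric] mult.commute)
qed simp

lemma alt_prod_ge:
  assumes "\<And>k. k \<in> {1..n} \<Longrightarrow> positive_mat (A k)" "\<And>k. k \<in> {1..n} \<Longrightarrow> positive_mat (B k)"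
    and "\<And>k. k \<in> {1..n} \<Longrightarrow> r *\<^sub>R v \<le> A k *v (B k *v v)" "0 \<le> r"
  shows "(r ^ n) *\<^sub>R v \<le> alt_prod A B n *v v"
  using assms
proof (induction n)
  case (Suc n)
  let ?A = "A (Suc n)" and ?B = "B (Suc n)"
  have "(r ^ n) *\<^sub>R (r *\<^sub>R v) \<le> (r ^ n) *\<^sub>R (?A *v (?B *v v))"
    using Suc.prems(3)[of "Suc n"] \<open>0 \<le> r\<close>
    by (auto simp: less_eq_vec_def mult.assoc intro!: mult_left_mono)
  also have "\<dots> = ?A *v (?B *v ((r ^ n) *\<^sub>R v))"
    by (simp add: matrix_vector_mult_scaleR)
  also have "\<dots> \<le> ?A *v (?B *v (alt_prod A B n *v v))"
    using Suc by (intro positive_mat_mono) auto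
  finally show ?case
    by (simp add: matrix_vector_mul_assoc[symmetric] mult.commute)
qed simp

text \<open>All the vectors \<open>A *v (B *v v)\<close> lie below one fixed vector, the iterated
  envelope, and a multiple of the positive \<open>v\<close> dominates it.\<close>

lemma obtain_common_growth_bound:
  fixes \<A> :: "(real^'m^'n) set" and \<B> :: "(real^'n^'m) set"
  assumes "compact \<A>" "compact \<B>" "\<And>A. A \<in> \<A> \<Longrightarrow> positive_mat A" "positive_vec v"
  obtains r where "0 \<le> r" "\<And>A B. A \<in> \<A> \<Longrightarrow> B \<in> \<B> \<Longrightarrow> A *v (B *v v) \<le> r *\<^sub>R v"
proof -
  let ?w = "sup_env \<A> (sup_env \<B> v)"
  obtain r where r: "?w \<le> r *\<^sub>R v"
    by (rule obtain_tight_multiple[OF assms(4)])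
  \<comment> \<open>\<open>obtain_tight_multiple\<close> says nothing about the sign of
    \<open>r\<close>; the maximum with 0 provides it.\<close>
  have "A *v (B *v v) \<le> max 0 r *\<^sub>R v" if "A \<in> \<A>" "B \<in> \<B>" for A B
  proof -
    have "A *v (B *v v) \<le> A *v sup_env \<B> v"
      using assms that by (intro positive_mat_mono sup_env_upper) auto
    also have "\<dots> \<le> ?w"
      using assms that by (intro sup_env_upper) auto
    also note r
    also have "r *\<^sub>R v \<le> max 0 r *\<^sub>R v"
      using assms(4) by (auto simp: less_eq_vec_def positive_vec_def order_less_imp_le intro!: mult_right_mono)
    finally show ?thesis .
  qed
  then show thesis
    using that[of "max 0 r"] by simp
qed

text \<open>The crude bounds \<open>m\<close> and \<open>M\<close> only keep the real suprema and infima from being junk values.\<close>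

lemma saddle_value_bounds:
  fixes f :: "'a \<Rightarrow> 'b \<Rightarrow> real"
  assumes "x0 \<in> S" "y0 \<in> T"
    and lower: "\<And>y. y \<in> T \<Longrightarrow> l \<le> f x0 y" and upper: "\<And>x. x \<in> S \<Longrightarrow> f x y0 \<le> u"
    and bounds: "\<And>x y. x \<in> S \<Longrightarrow> y \<in> T \<Longrightarrow> m \<le> f x y" "\<And>x y. x \<in> S \<Longrightarrow> y \<in> T \<Longrightarrow> f x y \<le> M"
  shows "(SUP x\<in>S. INF y\<in>T. f x y) \<in> {l..u}" "(INF y\<in>T. SUP x\<in>S. f x y) \<in> {l..u}"
proof -
  have below: "bdd_below (f x ` T)" if "x \<in> S" for x
    using bounds(1)[OF that] by (intro bdd_belowI2)
  have above: "bdd_above ((\<lambda>x. f x y) ` S)" if "y \<in> T" for y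
    using bounds(2)[OF _ that] by (intro bdd_aboveI2)
  \<comment> \<open>Answering every \<open>x\<close> with \<open>y0\<close> keeps each inner infimum
    at most \<open>u\<close>. This bounds the max-min value and also makes the outer supremum well
    behaved; \<open>le_sup\<close> plays the dual role.\<close>
  have inf_le: "(INF y\<in>T. f x y) \<le> u" if "x \<in> S" for x
    using below[OF that] \<open>y0 \<in> T\<close> upper[OF that] by (rule cINF_lower2)
  have le_sup: "l \<le> (SUP x\<in>S. f x y)" if "y \<in> T" for y
    using above[OF that] \<open>x0 \<in> S\<close> lower[OF that] by (meson cSUP_upper2)
  have "l \<le> (INF y\<in>T. f x0 y)"
    using \<open>y0 \<in> T\<close> lower by (intro cINF_greatest) auto
  then have "l \<le> (SUP x\<in>S. INF y\<in>T. f x y)"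
    using inf_le \<open>x0 \<in> S\<close> by (intro cSUP_upper2[of _ _ x0] bdd_aboveI2)
  moreover have "(SUP x\<in>S. INF y\<in>T. f x y) \<le> u"
    using \<open>x0 \<in> S\<close> inf_le by (intro cSUP_least) auto
  ultimately show "(SUP x\<in>S. INF y\<in>T. f x y) \<in> {l..u}"
    by simp
  have "(SUP x\<in>S. f x y0) \<le> u"
    using \<open>x0 \<in> S\<close> upper by (intro cSUP_least) auto
  then have "(INF y\<in>T. SUP x\<in>S. f x y) \<le> u"
    using le_sup \<open>y0 \<in> T\<close> by (intro cINF_lower2[of _ _ y0] bdd_belowI2)
  moreover have "l \<le> (INF y\<in>T. SUP x\<in>S. f x y)"
    using \<open>y0 \<in> T\<close> le_sup by (intro cINF_greatest) auto
  ultimately show "(INF y\<in>T. SUP x\<in>S. f x y) \<in> {l..u}"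
    by simp
qed

section \<open>Growth rates and the six limits\<close>

text \<open>The constants disappear because the \<open>n\<close>-th root of a fixed positive number
  tends to 1.\<close>

lemma root_tendsto_of_geometric_bounds:
  assumes "0 < c" "0 < C" "0 < s" and a: "\<And>n. 0 < n \<Longrightarrow> a n \<in> {c * s ^ n..C * s ^ n}"
  shows "(\<lambda>n. root n (a n)) \<longlonglongrightarrow> s"
proof (rule tendsto_sandwich)
  have *: "(\<lambda>n. root n d * s) \<longlonglongrightarrow> s" if "0 < d" for d
    using tendsto_mult[OF LIMSEQ_root_const[OF that] tendsto_const, of s] by simp
  show "(\<lambda>n. root n c * s) \<longlonglongrightarrow> s" "(\<lambda>n. root n C * s) \<longlonglongrightarrow> s"
    using * assms by auto
  have eq: "root n (d * s ^ n) = root n d * s" if "0 < n" for n d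
    using that \<open>0 < s\<close> by (simp add: real_root_mult real_root_power_cancel)
  show "\<forall>\<^sub>F n in sequentially. root n c * s \<le> root n (a n)"
    using eventually_gt_at_top[of 0]
    by eventually_elim (use a in \<open>auto simp: eq[symmetric]\<close>)
  show "\<forall>\<^sub>F n in sequentially. root n (a n) \<le> root n C * s"
    using eventually_gt_at_top[of 0]
    by eventually_elim (use a in \<open>auto simp: eq[symmetric]\<close>)
qed

text \<open>The functional \<open>\<phi>\<close> enters only through its comparison with growth
  along \<open>v\<close>, so that one argument covers norms and the spectral radius.\<close>

lemma game_growth_rate:
  fixes \<A> :: "(real^'m^'n) set" and \<B> :: "(real^'n^'m) set"
  assumes cmpt: "compact \<A>" "compact \<B>"
    and pos: "\<And>A. A \<in> \<A> \<Longrightarrow> positive_mat A" "\<And>B. B \<in> \<B> \<Longrightarrow> positive_mat B"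
    and v: "positive_vec v" and "0 < s" and As: "As \<in> \<A>" and Bs: "Bs \<in> \<B>"
    and le: "\<And>A. A \<in> \<A> \<Longrightarrow> A *v (Bs *v v) \<le> s *\<^sub>R v"
    and ge: "\<And>B. B \<in> \<B> \<Longrightarrow> s *\<^sub>R v \<le> As *v (B *v v)"
    and "0 < c" "0 < C"
    and \<phi>_ge: "\<And>X r. positive_mat X \<Longrightarrow> 0 \<le> r \<Longrightarrow> r *\<^sub>R v \<le> X *v v \<Longrightarrow> c * r \<le> \<phi> X"
    and \<phi>_le: "\<And>X r. positive_mat X \<Longrightarrow> X *v v \<le> r *\<^sub>R v \<Longrightarrow> \<phi> X \<le> C * r"
  shows "(\<lambda>n. root n (maxmin \<phi> \<A> \<B> n)) \<longlonglongrightarrow> s" "(\<lambda>n. root n (minmax \<phi> \<A> \<B> n)) \<longlonglongrightarrow> s"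
proof -
  obtain r where r: "0 \<le> r" "\<And>A B. A \<in> \<A> \<Longrightarrow> B \<in> \<B> \<Longrightarrow> A *v (B *v v) \<le> r *\<^sub>R v"
    using obtain_common_growth_bound[OF cmpt pos(1) v] by blast
  have bounds: "maxmin \<phi> \<A> \<B> n \<in> {c * s ^ n..C * s ^ n}"
      "minmax \<phi> \<A> \<B> n \<in> {c * s ^ n..C * s ^ n}"
    if n: "0 < n" for n
  proof -
    let ?S = "{1..n} \<rightarrow> \<A>" and ?T = "{1..n} \<rightarrow> \<B>"
    have X: "positive_mat (alt_prod A B n)" if "A \<in> ?S" "B \<in> ?T" for A B
      by (rule positive_alt_prod[OF pos(1)[OF Pi_mem[OF that(1)]] pos(2)[OF Pi_mem[OF that(2)]] n])
    have const: "(\<lambda>_. As) \<in> ?S" "(\<lambda>_. Bs) \<in> ?T"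
      using As Bs by auto
    have lower: "c * s ^ n \<le> \<phi> (alt_prod (\<lambda>_. As) B n)" if B: "B \<in> ?T" for B
    proof (rule \<phi>_ge[OF X[OF const(1) B]])
      show "(s ^ n) *\<^sub>R v \<le> alt_prod (\<lambda>_. As) B n *v v"
        using pos(1)[OF As] pos(2)[OF Pi_mem[OF B]] ge[OF Pi_mem[OF B]] \<open>0 < s\<close>
        by (intro alt_prod_ge) simp_all
    qed (use \<open>0 < s\<close> in simp)
    have upper: "\<phi> (alt_prod A (\<lambda>_. Bs) n) \<le> C * s ^ n" if A: "A \<in> ?S" for A
    proof (rule \<phi>_le[OF X[OF A const(2)]])
      show "alt_prod A (\<lambda>_. Bs) n *v v \<le> (s ^ n) *\<^sub>R v"
        using pos(1)[OF Pi_mem[OF A]] pos(2)[OF Bs] le[OF Pi_mem[OF A]] \<open>0 < s\<close>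
        by (intro alt_prod_le) simp_all
    qed
    \<comment> \<open>The crude lower bound 0 is the case \<open>r = 0\<close> of the growth
      comparison for \<open>\<phi>\<close>.\<close>
    have nonneg: "0 \<le> \<phi> (alt_prod A B n)" if "A \<in> ?S" "B \<in> ?T" for A B
    proof -
      have "0 *\<^sub>R v \<le> alt_prod A B n *v v"
        using positive_mat_mult_vec[OF X[OF that] positive_vec_nonneg[OF v] positive_vec_nonzero[OF v]]
        by (simp add: positive_vec_nonneg)
      from \<phi>_ge[OF X[OF that] _ this] show ?thesis
        by simp
    qed
    have bounded: "\<phi> (alt_prod A B n) \<le> C * r ^ n" if AB: "A \<in> ?S" "B \<in> ?T" for A B
      by (rule \<phi>_le[OF X[OF AB] alt_prod_le[OF pos(1)[OF Pi_mem[OF AB(1)]]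
            pos(2)[OF Pi_mem[OF AB(2)]] r(2)[OF Pi_mem[OF AB(1)] Pi_mem[OF AB(2)]] r(1)]])
    show "maxmin \<phi> \<A> \<B> n \<in> {c * s ^ n..C * s ^ n}" "minmax \<phi> \<A> \<B> n \<in> {c * s ^ n..C * s ^ n}"
      unfolding maxmin_def minmax_def
      using saddle_value_bounds[where f = "\<lambda>A B. \<phi> (alt_prod A B n)",
          OF const lower upper nonneg bounded] by blast+
  qed
  note limit = root_tendsto_of_geometric_bounds[OF \<open>0 < c\<close> \<open>0 < C\<close> \<open>0 < s\<close>]
  show "(\<lambda>n. root n (maxmin \<phi> \<A> \<B> n)) \<longlonglongrightarrow> s"
    by (rule limit[OF bounds(1)])
  show "(\<lambda>n. root n (minmax \<phi> \<A> \<B> n)) \<longlonglongrightarrow> s"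
    by (rule limit[OF bounds(2)])
qed

theorem theorem5p1:
  fixes \<A> :: "(real^'m^'n) set" and \<B> :: "(real^'n^'m) set" and \<nu> :: "real^'n^'n \<Rightarrow> real"
  assumes "is_norm \<nu>"
    and "\<A> \<noteq> {}" and "compact \<A>" and "H_set \<A>"
    and "\<B> \<noteq> {}" and "compact \<B>" and "H_set \<B>"
  shows "convergent (mu_seq \<nu> \<A> \<B>) \<and> convergent (eta_seq \<nu> \<A> \<B>) \<and>
    mu \<nu> \<A> \<B> = eta \<nu> \<A> \<B> \<and>
    ereal (eta \<nu> \<A> \<B>) = mu_hat \<A> \<B> \<and>
    mu_hat \<A> \<B> = eta_hat \<A> \<B> \<and>
    eta_hat \<A> \<B> = mu_check \<A> \<B> \<and>
    mu_check \<A> \<B> = eta_check \<A> \<B>"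
proof -
  obtain v s As Bs where v: "positive_vec v" and s: "0 < s" and As: "As \<in> \<A>" and Bs: "Bs \<in> \<B>"
    and le: "\<And>A. A \<in> \<A> \<Longrightarrow> A *v (Bs *v v) \<le> s *\<^sub>R v"
    and ge: "\<And>B. B \<in> \<B> \<Longrightarrow> s *\<^sub>R v \<le> As *v (B *v v)"
    using saddle_eigenvector[OF assms(2-7)] by blast
  have pos: "\<And>A. A \<in> \<A> \<Longrightarrow> positive_mat A" "\<And>B. B \<in> \<B> \<Longrightarrow> positive_mat B"
    using assms(4,7) by (auto simp: H_set_def)
  note rate = game_growth_rate[OF assms(3,6) pos v s As Bs le ge]
  \<comment> \<open>The Collatz-Wielandt bounds are sharp comparisons, hence both constants are
    1.\<close>
  have radius: "mu_bar_seq \<A> \<B> \<longlonglongrightarrow> s" "eta_bar_seq \<A> \<B> \<longlonglongrightarrow> s"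
    unfolding mu_bar_seq_def eta_bar_seq_def
    by (rule rate[where c = 1 and C = 1]; simp add: spectral_radius_le[OF _ v] spectral_radius_ge[OF _ v])+
  obtain c C where c: "0 < c" "0 < C" "\<And>X. c * norm X \<le> \<nu> X" "\<And>X. \<nu> X \<le> C * norm X"
    using is_norm_equivalent[OF assms(1)] by blast
  have vpos: "0 < v $ i" for i
    using v by (simp add: positive_vec_def)
  \<comment> \<open>Any index would do; \<open>undefined\<close> merely picks one.\<close>
  define d where "d = v $ undefined / norm v"
  define D where "D = (\<Sum>i\<in>UNIV. \<Sum>j\<in>UNIV. v $ i / v $ j)"
  have d: "0 < c * d" and D: "0 < C * D"
    using c(1,2) vpos positive_vec_nonzero[OF v]
    by (auto simp: d_def D_def intro!: mult_pos_pos sum_pos divide_pos_pos)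
  have \<nu>_ge: "c * d * r \<le> \<nu> X" if "0 \<le> r" "r *\<^sub>R v \<le> X *v v" for X r
    using mult_left_mono[OF norm_ge_of_growth[OF v that], of c undefined] c(1) c(3)[of X]
    by (simp add: d_def mult_ac)
  have \<nu>_le: "\<nu> X \<le> C * D * r" if "positive_mat X" "X *v v \<le> r *\<^sub>R v" for X r
    using mult_left_mono[OF norm_le_of_growth[OF that(1) v that(2)], of C] c(2) c(4)[of X]
    by (simp add: D_def[symmetric] mult.assoc order_trans)
  have norm: "mu_seq \<nu> \<A> \<B> \<longlonglongrightarrow> s" "eta_seq \<nu> \<A> \<B> \<longlonglongrightarrow> s"
    unfolding mu_seq_def eta_seq_def
    by (rule rate[where c = "c * d" and C = "C * D"],
        (assumption | rule d D \<nu>_ge \<nu>_le)+)+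
  have "mu \<nu> \<A> \<B> = s" "eta \<nu> \<A> \<B> = s"
    unfolding mu_def eta_def using norm by (auto intro: limI)
  moreover have "mu_hat \<A> \<B> = ereal s" "mu_check \<A> \<B> = ereal s"
      "eta_hat \<A> \<B> = ereal s" "eta_check \<A> \<B> = ereal s"
    \<comment> \<open>The spectral radius sequences converge, so their upper and lower limits
      coincide with \<open>s\<close>.\<close>
    unfolding mu_hat_def mu_check_def eta_hat_def eta_check_def
    by (intro lim_imp_Limsup lim_imp_Liminf tendsto_ereal radius; simp)+
  ultimately show ?thesis
    using norm by (auto simp: convergent_def)
qed

end
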